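(* Let $(X,\unlhd,\wedge,\vee,0,1)$ be a bounded trellis and let $T_D$ be the binary operation on $X$ given by $T_D(x,y)=x\wedge y$ if $x=1$ or $y=1$, and $T_D(x,y)=0$ otherwise (the smallest pseudo-t-norm, and smallest t-norm, on $X$). Then $T_D$ is $T$-distributive for every pseudo-t-norm $T$ on $X$.
   Context: A pseudo-order $\unlhd$ on a set $X$ is a reflexive and antisymmetric relation (not necessarily transitive); lower/upper bounds, infima and suprema are defined as for partially ordered sets (they are unique when they exist). A trellis $(X,\unlhd,\wedge,\vee)$ is a set with a pseudo-order in which any two elements $x,y$ have an infimum $x\wedge y$ and a supremum $x\vee y$. It is bounded, written $(X,\unlhd,\wedge,\vee,0,1)$, if it has elements $0,1$ with $0\unlhd x\unlhd 1$ for all $x\in X$. An element $\alpha\in X$ is right-transitive if $\alpha\unlhd x\unlhd y$ implies $\alpha\unlhd y$; left-transitive if $x\unlhd y\unlhd\alpha$ implies $x\unlhd\alpha$; middle-transitive if $x\unlhd\alpha\unlhd y$ implies $x\unlhd y$ (for all $x,y\in X$); transitive if all three hold. A triple $(x,y,z)$ is $\wedge$-associative if $(x\wedge y)\wedge z=x\wedge(y\wedge z)$, and $\vee$-associative if $(x\vee y)\vee z=x\vee(y\vee z)$. An element is $\wedge$-associative (resp. $\vee$-associative) if every triple in $X^3$ containing it is $\wedge$-associative (resp. $\vee$-associative). A binary operation $F$ on $X$ is weakly-increasing if, whenever $x\unlhd y$ and at least one of $x,y$ is transitive, $F(x,z)\unlhd F(y,z)$ for all $z\in X$. It is weakly-associative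 if $F(x,F(y,z))=F(F(x,y),z)$ for all $x,y,z\in X$ such that at least one of $x,y,z$ is $\wedge$-associative or at least one of $x,y,z$ is $\vee$-associative. A pseudo-t-norm on $X$ is a commutative, weakly-increasing, weakly-associative binary operation $T$ with $T(1,x)=x$ for all $x\in X$. A t-norm on $X$ is a commutative, associative binary operation $T$ that is increasing ($x\unlhd y$ implies $T(x,z)\unlhd T(y,z)$ for all $z\in X$) and satisfies $T(1,x)=x$ for all $x\in X$. For binary operations $F_1,F_2$ on $X$, $F_1$ is $F_2$-distributive if $F_1(x,F_2(y,z))=F_2(F_1(x,y),F_1(x,z))$ for all $x,y,z\in X$ with $(y,z)\neq(0,0)$ and $(y,z)\neq(1,1)$. *)

theory Defs
  imports Main
begin

text \<open>
  All notions are relative to a carrier set \<open>X\<close>; operations are total functions of the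
  ambient type that are only constrained on \<open>X\<close>.
\<close>

definition is_infimum :: "'a set \<Rightarrow> ('a \<Rightarrow> 'a \<Rightarrow> bool) \<Rightarrow> 'a set \<Rightarrow> 'a \<Rightarrow> bool" where
  "is_infimum X le A m \<longleftrightarrow>
     m \<in> X \<and> (\<forall>a\<in>A. le m a) \<and> (\<forall>l\<in>X. (\<forall>a\<in>A. le l a) \<longrightarrow> le l m)"

definition is_supremum :: "'a set \<Rightarrow> ('a \<Rightarrow> 'a \<Rightarrow> bool) \<Rightarrow> 'a set \<Rightarrow> 'a \<Rightarrow> bool" where
  "is_supremum X le A s \<longleftrightarrow>
     s \<in> X \<and> (\<forall>a\<in>A. le a s) \<and> (\<forall>u\<in>X. (\<forall>a\<in>A. le a u) \<longrightarrow> le s u)"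

text \<open>No transitivity is required of the order.\<close>

locale pseudo_order =
  fixes X :: "'a set" and le :: "'a \<Rightarrow> 'a \<Rightarrow> bool" (infix \<open>\<unlhd>\<close> 50)
  assumes refl_le: "reflp_on X (\<unlhd>)"
    and antisym_le: "antisymp_on X (\<unlhd>)"

locale trellis = pseudo_order X le
  for X :: "'a set" and le :: "'a \<Rightarrow> 'a \<Rightarrow> bool" (infix \<open>\<unlhd>\<close> 50) +
  fixes meet :: "'a \<Rightarrow> 'a \<Rightarrow> 'a" and join :: "'a \<Rightarrow> 'a \<Rightarrow> 'a"
  assumes meet_inf: "\<lbrakk>x \<in> X; y \<in> X\<rbrakk> \<Longrightarrow> is_infimum X (\<unlhd>) {x, y} (meet x y)"
    and join_sup: "\<lbrakk>x \<in> X; y \<in> X\<rbrakk> \<Longrightarrow> is_supremum X (\<unlhd>) {x, y} (join x y)"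

locale bounded_trellis = trellis X le meet join
  for X :: "'a set" and le :: "'a \<Rightarrow> 'a \<Rightarrow> bool" (infix \<open>\<unlhd>\<close> 50)
    and meet :: "'a \<Rightarrow> 'a \<Rightarrow> 'a" and join :: "'a \<Rightarrow> 'a \<Rightarrow> 'a" +
  fixes zero :: 'a and one :: 'a
  assumes zero_closed: "zero \<in> X"
    and one_closed: "one \<in> X"
    and zero_le: "x \<in> X \<Longrightarrow> zero \<unlhd> x"
    and le_one: "x \<in> X \<Longrightarrow> x \<unlhd> one"

definition right_transitive :: "'a set \<Rightarrow> ('a \<Rightarrow> 'a \<Rightarrow> bool) \<Rightarrow> 'a \<Rightarrow> bool" where
  "right_transitive X le a \<longleftrightarrow> (\<forall>x\<in>X. \<forall>y\<in>X. le a x \<and> le x y \<longrightarrow> le a y)"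

definition left_transitive :: "'a set \<Rightarrow> ('a \<Rightarrow> 'a \<Rightarrow> bool) \<Rightarrow> 'a \<Rightarrow> bool" where
  "left_transitive X le a \<longleftrightarrow> (\<forall>x\<in>X. \<forall>y\<in>X. le x y \<and> le y a \<longrightarrow> le x a)"

definition middle_transitive :: "'a set \<Rightarrow> ('a \<Rightarrow> 'a \<Rightarrow> bool) \<Rightarrow> 'a \<Rightarrow> bool" where
  "middle_transitive X le a \<longleftrightarrow> (\<forall>x\<in>X. \<forall>y\<in>X. le x a \<and> le a y \<longrightarrow> le x y)"

definition transitive_elem :: "'a set \<Rightarrow> ('a \<Rightarrow> 'a \<Rightarrow> bool) \<Rightarrow> 'a \<Rightarrow> bool" where
  "transitive_elem X le a \<longleftrightarrow>
     right_transitive X le a \<and> left_transitive X le a \<and> middle_transitive X le a"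

text \<open>
  Taking \<open>f\<close> to be the meet (resp. the join) gives meet- (resp. join-) associative triples
  and elements.
\<close>

definition assoc_triple :: "('a \<Rightarrow> 'a \<Rightarrow> 'a) \<Rightarrow> 'a \<Rightarrow> 'a \<Rightarrow> 'a \<Rightarrow> bool" where
  "assoc_triple f x y z \<longleftrightarrow> f (f x y) z = f x (f y z)"

definition assoc_elem :: "'a set \<Rightarrow> ('a \<Rightarrow> 'a \<Rightarrow> 'a) \<Rightarrow> 'a \<Rightarrow> bool" where
  "assoc_elem X f a \<longleftrightarrow> (\<forall>x\<in>X. \<forall>y\<in>X. \<forall>z\<in>X. a \<in> {x, y, z} \<longrightarrow> assoc_triple f x y z)"

definition binary_op_on :: "'a set \<Rightarrow> ('a \<Rightarrow> 'a \<Rightarrow> 'a) \<Rightarrow> bool" where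
  "binary_op_on X F \<longleftrightarrow> (\<forall>x\<in>X. \<forall>y\<in>X. F x y \<in> X)"

definition commutative_on :: "'a set \<Rightarrow> ('a \<Rightarrow> 'a \<Rightarrow> 'a) \<Rightarrow> bool" where
  "commutative_on X F \<longleftrightarrow> (\<forall>x\<in>X. \<forall>y\<in>X. F x y = F y x)"

definition associative_on :: "'a set \<Rightarrow> ('a \<Rightarrow> 'a \<Rightarrow> 'a) \<Rightarrow> bool" where
  "associative_on X F \<longleftrightarrow> (\<forall>x\<in>X. \<forall>y\<in>X. \<forall>z\<in>X. F x (F y z) = F (F x y) z)"

definition increasing_on ::
  "'a set \<Rightarrow> ('a \<Rightarrow> 'a \<Rightarrow> bool) \<Rightarrow> ('a \<Rightarrow> 'a \<Rightarrow> 'a) \<Rightarrow> bool" where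
  "increasing_on X le F \<longleftrightarrow>
     (\<forall>x\<in>X. \<forall>y\<in>X. le x y \<longrightarrow> (\<forall>z\<in>X. le (F x z) (F y z)))"

definition weakly_increasing ::
  "'a set \<Rightarrow> ('a \<Rightarrow> 'a \<Rightarrow> bool) \<Rightarrow> ('a \<Rightarrow> 'a \<Rightarrow> 'a) \<Rightarrow> bool" where
  "weakly_increasing X le F \<longleftrightarrow>
     (\<forall>x\<in>X. \<forall>y\<in>X. le x y \<and> (transitive_elem X le x \<or> transitive_elem X le y) \<longrightarrow>
        (\<forall>z\<in>X. le (F x z) (F y z)))"

definition weakly_associative ::
  "'a set \<Rightarrow> ('a \<Rightarrow> 'a \<Rightarrow> 'a) \<Rightarrow> ('a \<Rightarrow> 'a \<Rightarrow> 'a) \<Rightarrow> ('a \<Rightarrow> 'a \<Rightarrow> 'a) \<Rightarrow> bool" where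
  "weakly_associative X meet join F \<longleftrightarrow>
     (\<forall>x\<in>X. \<forall>y\<in>X. \<forall>z\<in>X.
        (\<exists>a\<in>{x, y, z}. assoc_elem X meet a) \<or> (\<exists>a\<in>{x, y, z}. assoc_elem X join a) \<longrightarrow>
        F x (F y z) = F (F x y) z)"

definition pseudo_tnorm ::
  "'a set \<Rightarrow> ('a \<Rightarrow> 'a \<Rightarrow> bool) \<Rightarrow> ('a \<Rightarrow> 'a \<Rightarrow> 'a) \<Rightarrow> ('a \<Rightarrow> 'a \<Rightarrow> 'a) \<Rightarrow> 'a \<Rightarrow>
    ('a \<Rightarrow> 'a \<Rightarrow> 'a) \<Rightarrow> bool" where
  "pseudo_tnorm X le meet join one T \<longleftrightarrow>
     binary_op_on X T \<and> commutative_on X T \<and> weakly_increasing X le T \<and>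
     weakly_associative X meet join T \<and> (\<forall>x\<in>X. T one x = x)"

definition tnorm ::
  "'a set \<Rightarrow> ('a \<Rightarrow> 'a \<Rightarrow> bool) \<Rightarrow> 'a \<Rightarrow> ('a \<Rightarrow> 'a \<Rightarrow> 'a) \<Rightarrow> bool" where
  "tnorm X le one T \<longleftrightarrow>
     binary_op_on X T \<and> commutative_on X T \<and> associative_on X T \<and>
     increasing_on X le T \<and> (\<forall>x\<in>X. T one x = x)"

definition T_D :: "('a \<Rightarrow> 'a \<Rightarrow> 'a) \<Rightarrow> 'a \<Rightarrow> 'a \<Rightarrow> 'a \<Rightarrow> 'a \<Rightarrow> 'a" where
  "T_D meet zero one x y = (if x = one \<or> y = one then meet x y else zero)"

text \<open>\<open>F\<^sub>1\<close> is \<open>F\<^sub>2\<close>-distributive; the pairs \<open>(0,0)\<close> and \<open>(1,1)\<close> are exempt by convention.\<close>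

definition distributive_over ::
  "'a set \<Rightarrow> 'a \<Rightarrow> 'a \<Rightarrow> ('a \<Rightarrow> 'a \<Rightarrow> 'a) \<Rightarrow> ('a \<Rightarrow> 'a \<Rightarrow> 'a) \<Rightarrow> bool" where
  "distributive_over X zero one F\<^sub>1 F\<^sub>2 \<longleftrightarrow>
     (\<forall>x\<in>X. \<forall>y\<in>X. \<forall>z\<in>X. (y, z) \<noteq> (zero, zero) \<and> (y, z) \<noteq> (one, one) \<longrightarrow>
        F\<^sub>1 x (F\<^sub>2 y z) = F\<^sub>2 (F\<^sub>1 x y) (F\<^sub>1 x z))"

lemma tnorm_imp_pseudo_tnorm:
  "tnorm X le one T \<Longrightarrow> pseudo_tnorm X le meet join one T"
  unfolding tnorm_def pseudo_tnorm_def associative_on_def weakly_associative_def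
    increasing_on_def weakly_increasing_def
  by blast

context bounded_trellis
begin

lemma antisymD: "\<lbrakk>x \<in> X; y \<in> X; x \<unlhd> y; y \<unlhd> x\<rbrakk> \<Longrightarrow> x = y"
  using antisym_le by (auto dest: antisymp_onD)

lemma reflD: "x \<in> X \<Longrightarrow> x \<unlhd> x"
  using refl_le by (auto dest: reflp_onD)

lemma meet_one:
  assumes "x \<in> X"
  shows "meet one x = x" and "meet x one = x"
proof -
  have "is_infimum X (\<unlhd>) {one, x} (meet one x)" "is_infimum X (\<unlhd>) {x, one} (meet x one)"
    using assms one_closed by (auto intro: meet_inf)
  then show "meet one x = x" "meet x one = x"
    using assms unfolding is_infimum_def by (auto intro!: antisymD intro: reflD le_one)
qed

text \<open>\<open>T_D\<close> is the smallest pseudo-t-norm, and the smallest t-norm, on \<open>X\<close>.\<close>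

lemma tnorm_T_D: "tnorm X (\<unlhd>) one (T_D meet zero one)"
proof -
  have "one \<unlhd> y \<Longrightarrow> y \<in> X \<Longrightarrow> y = one" for y
    using antisymD le_one one_closed by blast
  moreover have "zero = one \<Longrightarrow> y \<in> X \<Longrightarrow> y = one" for y
    using antisymD le_one zero_le one_closed by blast
  ultimately show ?thesis
    unfolding tnorm_def binary_op_on_def commutative_on_def associative_on_def
      increasing_on_def T_D_def
    by (auto simp: meet_one zero_closed one_closed reflD zero_le)
qed

lemma pseudo_tnorm_T_D: "pseudo_tnorm X (\<unlhd>) meet join one (T_D meet zero one)"
  by (rule tnorm_imp_pseudo_tnorm[OF tnorm_T_D])

lemma T_D_le_pseudo_tnorm:
  assumes "pseudo_tnorm X (\<unlhd>) meet join one T" "x \<in> X" "y \<in> X"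
  shows "T_D meet zero one x y \<unlhd> T x y"
proof -
  have "T x one = x" "T one y = y" "T x y \<in> X"
    using assms one_closed unfolding pseudo_tnorm_def commutative_on_def binary_op_on_def
    by auto
  then show ?thesis
    using assms(2,3) by (auto simp: T_D_def meet_one reflD zero_le)
qed

lemma T_D_le_tnorm:
  "\<lbrakk>tnorm X (\<unlhd>) one T; x \<in> X; y \<in> X\<rbrakk> \<Longrightarrow> T_D meet zero one x y \<unlhd> T x y"
  by (rule T_D_le_pseudo_tnorm[OF tnorm_imp_pseudo_tnorm])

end

end

theory Submission
  imports Defs
begin

text \<open>
  The key point is that a pseudo-t-norm \<open>T\<close> lies below both of its arguments: the top element is
  transitive, so weak increasingness may be applied to \<open>x \<unlhd> 1\<close> and gives \<open>T x y \<unlhd> T 1 y = y\<close>.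
  Hence \<open>0\<close> annihilates \<open>T\<close> (\<open>pseudo_tnorm_zero\<close>), and \<open>T y z = 1\<close> forces \<open>y = z = 1\<close>
  (\<open>pseudo_tnorm_eq_one\<close>).

  Distributivity is immediate for \<open>x = 1\<close>, since then both sides are \<open>T y z\<close>. For \<open>x \<noteq> 1\<close> both sides
  are \<open>0\<close>. On the left, \<open>T y z \<noteq> 1\<close> because the pair \<open>(1, 1)\<close> is exempt, so \<open>T\<^sub>D\<close> vanishes there. On
  the right, at least one of \<open>y\<close>, \<open>z\<close> differs from \<open>1\<close>, so at least one argument of the outer \<open>T\<close>
  is \<open>0\<close>.
\<close>

context bounded_trellis
begin

lemma one_le_iff: "y \<in> X \<Longrightarrow> one \<unlhd> y \<longleftrightarrow> y = one"
  using antisymD le_one one_closed by blast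

lemma transitive_elem_one: "transitive_elem X (\<unlhd>) one"
  unfolding transitive_elem_def right_transitive_def left_transitive_def middle_transitive_def
  by (auto simp: one_le_iff le_one)

lemma T_D_one_left: "y \<in> X \<Longrightarrow> T_D meet zero one one y = y"
  by (simp add: T_D_def meet_one)

lemma T_D_one_right: "x \<in> X \<Longrightarrow> T_D meet zero one x one = x"
  by (simp add: T_D_def meet_one)

lemma T_D_zero: "x \<noteq> one \<Longrightarrow> y \<noteq> one \<Longrightarrow> T_D meet zero one x y = zero"
  by (simp add: T_D_def)

lemma pseudo_tnorm_closed:
  "\<lbrakk>pseudo_tnorm X (\<unlhd>) meet join one T; x \<in> X; y \<in> X\<rbrakk> \<Longrightarrow> T x y \<in> X"
  unfolding pseudo_tnorm_def binary_op_on_def by blast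

lemma pseudo_tnorm_commute:
  "\<lbrakk>pseudo_tnorm X (\<unlhd>) meet join one T; x \<in> X; y \<in> X\<rbrakk> \<Longrightarrow> T x y = T y x"
  unfolding pseudo_tnorm_def commutative_on_def by blast

text \<open>
  Weak increasingness suffices here because the comparison \<open>x \<unlhd> one\<close> involves a transitive element.
\<close>

lemma pseudo_tnorm_le_right:
  assumes "pseudo_tnorm X (\<unlhd>) meet join one T" "x \<in> X" "y \<in> X"
  shows "T x y \<unlhd> y"
proof -
  have "T x y \<unlhd> T one y"
    using assms transitive_elem_one le_one one_closed
    unfolding pseudo_tnorm_def weakly_increasing_def by blast
  then show ?thesis
    using assms unfolding pseudo_tnorm_def by simp
qed

lemma pseudo_tnorm_zero:
  assumes "pseudo_tnorm X (\<unlhd>) meet join one T" "x \<in> X"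
  shows "T x zero = zero" and "T zero x = zero"
proof -
  show right_zero: "T x zero = zero"
    using assms(2) zero_closed pseudo_tnorm_closed[OF assms zero_closed]
      pseudo_tnorm_le_right[OF assms zero_closed]
    by (blast intro: antisymD zero_le)
  show "T zero x = zero"
    using pseudo_tnorm_commute[OF assms zero_closed] right_zero by simp
qed

lemma pseudo_tnorm_eq_one:
  assumes "pseudo_tnorm X (\<unlhd>) meet join one T" "y \<in> X" "z \<in> X" "T y z = one"
  shows "y = one \<and> z = one"
proof -
  have "T y z \<unlhd> z" "T z y \<unlhd> y"
    using pseudo_tnorm_le_right[OF assms(1)] assms(2,3) by blast+
  moreover have "T z y = one"
    using pseudo_tnorm_commute[OF assms(1-3)] assms(4) by simp
  ultimately show ?thesis
    using assms by (simp add: one_le_iff)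
qed

lemma T_D_distributive_over_pseudo_tnorm:
  assumes T: "pseudo_tnorm X (\<unlhd>) meet join one T"
  shows "distributive_over X zero one (T_D meet zero one) T"
  unfolding distributive_over_def
proof (intro ballI impI)
  fix x y z
  assume X: "x \<in> X" "y \<in> X" "z \<in> X" and "(y, z) \<noteq> (zero, zero) \<and> (y, z) \<noteq> (one, one)"
  then have yz: "y \<noteq> one \<or> z \<noteq> one"
    by simp
  let ?D = "T_D meet zero one"
  show "?D x (T y z) = T (?D x y) (?D x z)"
  proof (cases "x = one")
    case True
    then show ?thesis
      using X by (simp add: T_D_one_left pseudo_tnorm_closed[OF T])
  next
    case False
    have "?D x (T y z) = zero"
      using False yz pseudo_tnorm_eq_one[OF T X(2,3)] by (auto intro: T_D_zero)
    also have "zero = T (?D x y) (?D x z)"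
      using False yz X
      by (cases "y = one"; cases "z = one")
        (simp_all add: T_D_one_right T_D_zero pseudo_tnorm_zero[OF T] zero_closed)
    finally show ?thesis .
  qed
qed

end

theorem proposition5p2:
  fixes X :: "'a set"
    and le :: "'a \<Rightarrow> 'a \<Rightarrow> bool"
    and meet join :: "'a \<Rightarrow> 'a \<Rightarrow> 'a"
    and zero one :: 'a
  assumes "bounded_trellis X le meet join zero one"
  shows "\<forall>T. pseudo_tnorm X le meet join one T \<longrightarrow>
           distributive_over X zero one (T_D meet zero one) T"
  using bounded_trellis.T_D_distributive_over_pseudo_tnorm[OF assms] by blast

end
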